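(* Let $\Phi=(\phi_j)_{j=1}^n$ and $\Psi=(\psi_j)_{j=1}^n$ be frames for a $d$-dimensional non-isotropic space $V$ over $\mathbb{F}$, and suppose $\langle\phi_j,\phi_k\rangle\neq0$ and $\langle\psi_j,\psi_k\rangle\neq0$ for all $j\neq k$ in $[n]$. Then $\Phi$ and $\Psi$ are switching equivalent if and only if (i) $\Delta(\phi_j,\phi_k)=\Delta(\psi_j,\psi_k)$ for all $j,k\in[n]$, and (ii) $\Delta(\phi_j,\phi_k,\phi_\ell)=\Delta(\psi_j,\psi_k,\psi_\ell)$ for all $j,k,\ell\in[n]$.
   Context: $\mathbb{F}$ is a finite field of one of two kinds: (Case U) $\mathbb{F}=\mathbb{F}_{q^2}$ with involution $x^\sigma=x^q$, or (Case O) $\mathbb{F}=\mathbb{F}_q$ with $x^\sigma=x$; in both cases $q$ is odd. A non-isotropic space is a finite-dimensional $\mathbb{F}$-vector space with a non-degenerate Hermitian scalar product $\langle\cdot,\cdot\rangle$ (linear in the second argument, $\langle u,v\rangle=\langle v,u\rangle^\sigma$, non-degenerate). A frame for $V$ is a sequence of vectors spanning $V$. A unitary $U:V\to V$ is an invertible linear map preserving $\langle\cdot,\cdot\rangle$; $\Phi,\Psi$ are switching equivalent if there are a unitary $U$ and $t_1,\dots,t_n$ with $t_it_i^\sigma=1$ such that $\psi_j=t_jU\phi_j$ for all $j$. $\Delta(\phi_j,\phi_k)=\langle\phi_j,\phi_k\rangle\langle\phi_k,\phi_j\rangle$ and $\Delta(\phi_j,\phi_k,\phi_\ell)=\langle\phi_j,\phi_k\rangle\langle\phi_k,\phi_\ell\rangle\langle\phi_\ell,\phi_j\rangle$.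 *)

theory Defs
  imports Complex_Main
begin

text \<open>
  The finite field is a type of class \<open>field\<close> and \<open>finite\<close>; that \<open>q\<close> is a prime power
  follows from its relation to the cardinality of this type.
\<close>

definition case_U :: "nat \<Rightarrow> ('a::{field,finite} \<Rightarrow> 'a) \<Rightarrow> bool" where
  "case_U q \<sigma> \<longleftrightarrow> odd q \<and> card (UNIV :: 'a set) = q ^ 2 \<and> (\<forall>x. \<sigma> x = x ^ q)"

definition case_O :: "nat \<Rightarrow> ('a::{field,finite} \<Rightarrow> 'a) \<Rightarrow> bool" where
  "case_O q \<sigma> \<longleftrightarrow> odd q \<and> card (UNIV :: 'a set) = q \<and> (\<forall>x. \<sigma> x = x)"

locale nonisotropic_space = vector_space scale
  for scale :: "'a::{field,finite} \<Rightarrow> 'v::ab_group_add \<Rightarrow> 'v" +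
  fixes \<sigma> :: "'a \<Rightarrow> 'a"
    and ip :: "'v \<Rightarrow> 'v \<Rightarrow> 'a"
  assumes finite_dim: "\<exists>B. finite B \<and> span B = UNIV"
    and ip_add_right: "ip u (v + w) = ip u v + ip u w"
    and ip_scale_right: "ip u (scale c v) = c * ip u v"
    and ip_hermitian: "ip u v = \<sigma> (ip v u)"
    and ip_nondegenerate: "(\<forall>v. ip u v = 0) \<Longrightarrow> u = 0"

text \<open>
  A sequence of length \<open>n\<close> is a function on \<open>nat\<close>; only its values on \<open>{1..n}\<close> matter.
\<close>

definition is_frame ::
    "('a::field \<Rightarrow> 'v::ab_group_add \<Rightarrow> 'v) \<Rightarrow> nat \<Rightarrow> (nat \<Rightarrow> 'v) \<Rightarrow> bool" where
  "is_frame scale n \<phi> \<longleftrightarrow> module.span scale (\<phi> ` {1..n}) = UNIV"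

definition is_unitary ::
    "('a::field \<Rightarrow> 'v::ab_group_add \<Rightarrow> 'v) \<Rightarrow> ('v \<Rightarrow> 'v \<Rightarrow> 'a) \<Rightarrow> ('v \<Rightarrow> 'v) \<Rightarrow> bool" where
  "is_unitary scale ip U \<longleftrightarrow>
     Vector_Spaces.linear scale scale U \<and> bij U \<and> (\<forall>u v. ip (U u) (U v) = ip u v)"

definition switching_equivalent ::
    "('a::field \<Rightarrow> 'v::ab_group_add \<Rightarrow> 'v) \<Rightarrow> ('a \<Rightarrow> 'a) \<Rightarrow> ('v \<Rightarrow> 'v \<Rightarrow> 'a) \<Rightarrow>
      nat \<Rightarrow> (nat \<Rightarrow> 'v) \<Rightarrow> (nat \<Rightarrow> 'v) \<Rightarrow> bool" where
  "switching_equivalent scale \<sigma> ip n \<phi> \<psi> \<longleftrightarrow>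
     (\<exists>U t. is_unitary scale ip U \<and>
        (\<forall>j\<in>{1..n}. t j * \<sigma> (t j) = 1) \<and>
        (\<forall>j\<in>{1..n}. \<psi> j = scale (t j) (U (\<phi> j))))"

definition double_product :: "('v \<Rightarrow> 'v \<Rightarrow> 'a::field) \<Rightarrow> 'v \<Rightarrow> 'v \<Rightarrow> 'a" where
  "double_product ip u v = ip u v * ip v u"

definition triple_product :: "('v \<Rightarrow> 'v \<Rightarrow> 'a::field) \<Rightarrow> 'v \<Rightarrow> 'v \<Rightarrow> 'v \<Rightarrow> 'a" where
  "triple_product ip u v w = ip u v * ip v w * ip w u"

end

theory Submission
  imports Defs
begin

text \<open>
  If all inner products of distinct vectors are nonzero, the switching factors are forced up to a
  common unit: normalising the first one to be \<open>1\<close>, the \<open>k\<close>-th must be the quotient of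
  \<open>\<langle>\<psi>\<^sub>1, \<psi>\<^sub>k\<rangle>\<close> by \<open>\<langle>\<phi>\<^sub>1, \<phi>\<^sub>k\<rangle>\<close>. The double products make these factors units, and the triple products
  through the index \<open>1\<close> show that the rescaled \<open>\<Phi>\<close> has the same Gram matrix as \<open>\<Psi>\<close>. By
  non-degeneracy, two spanning families with equal Gram matrices differ by a unitary.
\<close>

text \<open>Both cases are treated uniformly through these three facts. In the unitary case
  \<open>\<sigma>\<close> is a power map, and its value at 0 is right because an odd exponent is
  positive.\<close>

lemma case_sigma_monoid_hom:
  assumes "case_U q \<sigma> \<or> case_O q \<sigma>"
  shows "\<sigma> (x * y) = \<sigma> x * \<sigma> y" "\<sigma> 0 = 0" "\<sigma> 1 = 1"
  using assms by (auto simp: case_U_def case_O_def power_mult_distrib odd_pos)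

context nonisotropic_space
begin

lemma ip_zero_right [simp]: "ip u 0 = 0"
  using ip_scale_right[of u 0 0] by simp

lemma ip_diff_right: "ip u (v - w) = ip u v - ip u w"
  using ip_add_right[of u "v - w" w] by simp

lemma ip_scale_left:
  assumes "\<And>x y. \<sigma> (x * y) = \<sigma> x * \<sigma> y"
  shows "ip (scale c u) v = \<sigma> c * ip u v"
  by (metis assms ip_hermitian ip_scale_right)

lemma subspace_ip_zero: "subspace {v. ip u v = 0}"
  by (auto simp: subspace_def ip_add_right ip_scale_right)

text \<open>Hermitian symmetry moves \<open>v - w\<close> into the first slot, where its annihilator
  is a subspace. Containing a spanning family, this is everything, and non-degeneracy
  applies.\<close>

lemma eq_if_ip_spanning_eq:
  assumes "\<sigma> 0 = 0" "span (f ` A) = UNIV" "\<And>j. j \<in> A \<Longrightarrow> ip (f j) v = ip (f j) w"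
  shows "v = w"
proof -
  have "ip (v - w) (f j) = 0" if "j \<in> A" for j
    using that assms(1,3) ip_hermitian[of "v - w" "f j"] by (simp add: ip_diff_right)
  then have "span (f ` A) \<subseteq> {x. ip (v - w) x = 0}"
    by (intro span_minimal subspace_ip_zero) auto
  then show ?thesis
    using assms(2) ip_nondegenerate[of "v - w"] by auto
qed

text \<open>The families may be linearly dependent, so \<open>U v\<close> is specified not by
  coordinates but by its inner products with all \<open>g j\<close>; non-degeneracy makes such a
  vector unique.\<close>

lemma ex_unitary_if_same_gram:
  assumes zero: "\<sigma> 0 = 0"
    and f: "span (f ` A) = UNIV" and g: "span (g ` A) = UNIV"
    and gram: "\<And>j k. j \<in> A \<Longrightarrow> k \<in> A \<Longrightarrow> ip (g j) (g k) = ip (f j) (f k)"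
  shows "\<exists>U. is_unitary scale ip U \<and> (\<forall>j\<in>A. U (f j) = g j)"
proof -
  have "\<exists>w. \<forall>j\<in>A. ip (g j) w = ip (f j) v" for v
  proof -
    \<comment> \<open>Solvability in \<open>w\<close> is preserved by linear combinations, and for
      \<open>v = f k\<close> the Gram hypothesis offers \<open>w = g k\<close>.\<close>
    have "subspace {v. \<exists>w. \<forall>j\<in>A. ip (g j) w = ip (f j) v}"
    proof (rule subspaceI, safe)
      show "\<exists>w. \<forall>j\<in>A. ip (g j) w = ip (f j) 0"
        by (rule exI[of _ 0]) simp
    next
      fix x y w z
      assume "\<forall>j\<in>A. ip (g j) w = ip (f j) x" "\<forall>j\<in>A. ip (g j) z = ip (f j) y"
      then show "\<exists>w. \<forall>j\<in>A. ip (g j) w = ip (f j) (x + y)"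
        by (intro exI[of _ "w + z"]) (simp add: ip_add_right)
    next
      fix c x w
      assume "\<forall>j\<in>A. ip (g j) w = ip (f j) x"
      then show "\<exists>w. \<forall>j\<in>A. ip (g j) w = ip (f j) (scale c x)"
        by (intro exI[of _ "scale c w"]) (simp add: ip_scale_right)
    qed
    then have "span (f ` A) \<subseteq> {v. \<exists>w. \<forall>j\<in>A. ip (g j) w = ip (f j) v}"
      using gram by (intro span_minimal) blast+
    then show ?thesis
      using f by blast
  qed
  then obtain U where U: "\<And>v j. j \<in> A \<Longrightarrow> ip (g j) (U v) = ip (f j) v"
    by metis
  \<comment> \<open>Uniqueness reduces every identity between values of \<open>U\<close> to a
    comparison of inner products with the \<open>g j\<close>.\<close>
  have eqI: "v = w" if "\<And>j. j \<in> A \<Longrightarrow> ip (g j) v = ip (g j) w" for v w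
    using eq_if_ip_spanning_eq[OF zero g that] .
  have Uf: "U (f k) = g k" if "k \<in> A" for k
    using that by (intro eqI) (simp add: U gram)
  have add: "U (v + w) = U v + U w" for v w
    by (intro eqI) (simp add: U ip_add_right)
  have sc: "U (scale c v) = scale c (U v)" for c v
    by (intro eqI) (simp add: U ip_scale_right)
  have U0: "U 0 = 0"
    by (intro eqI) (simp add: U)
  have lin: "Vector_Spaces.linear scale scale U"
    by unfold_locales (simp_all add: add sc)
  have iso: "ip (U u) (U v) = ip u v" for u v
  proof -
    have "subspace {v. ip (U u) (U v) = ip u v}"
      by (auto simp: subspace_def U0 add sc ip_add_right ip_scale_right)
    \<comment> \<open>Swapping the arguments on both sides turns this into the defining property of
      \<open>U u\<close> against \<open>g k\<close>, under \<open>\<sigma>\<close>.\<close>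
    moreover have "ip (U u) (U (f k)) = ip u (f k)" if "k \<in> A" for k
      using that ip_hermitian[of "U u" "g k"] ip_hermitian[of u "f k"] by (simp add: Uf U)
    ultimately have "span (f ` A) \<subseteq> {v. ip (U u) (U v) = ip u v}"
      by (intro span_minimal) auto
    then show ?thesis
      using f by blast
  qed
  have "inj U"
  proof (rule injI)
    fix v w assume "U v = U w"
    then show "v = w"
      by (intro eq_if_ip_spanning_eq[OF zero f]) (metis iso)
  qed
  moreover have "surj U"
  proof -
    have "subspace (range U)"
      unfolding subspace_def using U0 add sc by (metis (no_types, lifting) rangeE rangeI)
    then have "span (g ` A) \<subseteq> range U"
      using Uf by (intro span_minimal image_subsetI) (metis rangeI)+
    then show ?thesis
      using g by blast
  qed
  ultimately show ?thesis
    using lin iso Uf unfolding is_unitary_def bij_def by blast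
qed

text \<open>Nonzero factors can be inverted, so each family lies in the span of the other. Hence a
  frame stays a frame after switching.\<close>

lemma span_scale_image:
  assumes "\<And>j. j \<in> A \<Longrightarrow> t j \<noteq> 0"
  shows "span ((\<lambda>j. scale (t j) (f j)) ` A) = span (f ` A)"
proof (rule span_eq[THEN iffD2], safe)
  fix j assume j: "j \<in> A"
  then show "scale (t j) (f j) \<in> span (f ` A)"
    by (intro span_scale span_base) blast
  have "f j = scale (inverse (t j)) (scale (t j) (f j))"
    using assms[OF j] by simp
  moreover have "\<dots> \<in> span ((\<lambda>j. scale (t j) (f j)) ` A)"
    using j by (intro span_scale[OF span_base]) blast
  ultimately show "f j \<in> span ((\<lambda>j. scale (t j) (f j)) ` A)"
    by simp
qed

lemma switching_factors_exist:
  assumes mult: "\<And>x y. \<sigma> (x * y) = \<sigma> x * \<sigma> y" and one: "\<sigma> 1 = 1"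
    and f: "\<And>j k. j \<in> A \<Longrightarrow> k \<in> A \<Longrightarrow> j \<noteq> k \<Longrightarrow> ip (f j) (f k) \<noteq> 0"
    and dbl: "\<And>j k. j \<in> A \<Longrightarrow> k \<in> A \<Longrightarrow>
      double_product ip (f j) (f k) = double_product ip (g j) (g k)"
    and tri: "\<And>j k l. j \<in> A \<Longrightarrow> k \<in> A \<Longrightarrow> l \<in> A \<Longrightarrow>
      triple_product ip (f j) (f k) (f l) = triple_product ip (g j) (g k) (g l)"
  shows "\<exists>t. (\<forall>j\<in>A. t j * \<sigma> (t j) = 1) \<and>
    (\<forall>j\<in>A. \<forall>k\<in>A. ip (g j) (g k) = \<sigma> (t j) * t k * ip (f j) (f k))"
proof (cases "A = {}")
  case False
  then obtain a where a: "a \<in> A" by blast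
  \<comment> \<open>The value at \<open>a\<close> is set separately, since \<open>f a\<close> may be
    isotropic and the quotient would then be a division by zero.\<close>
  define t where "t k = (if k = a then 1 else ip (g a) (g k) / ip (f a) (f k))" for k
  have ta: "t a = 1" by (simp add: t_def)
  have tk: "ip (g a) (g k) = t k * ip (f a) (f k)" if "k \<in> A" "k \<noteq> a" for k
    using f[of a k] that a by (simp add: t_def)
  have tk': "ip (g k) (g a) = \<sigma> (t k) * ip (f k) (f a)" if "k \<in> A" "k \<noteq> a" for k
    using tk[OF that] mult ip_hermitian by metis
  have unit: "t k * \<sigma> (t k) = 1" if k: "k \<in> A" for k
  proof (cases "k = a")
    case False
    have "ip (f a) (f k) * ip (f k) (f a)
        = (t k * \<sigma> (t k)) * (ip (f a) (f k) * ip (f k) (f a))"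
      using dbl[OF a k] tk[OF k False] tk'[OF k False]
      by (simp add: double_product_def mult_ac)
    then show ?thesis
      using f[OF a k] f[OF k a] False by simp
  qed (simp add: ta one)
  \<comment> \<open>On the diagonal the double and triple products are the square and the cube of
    one entry. Dividing cube by square recovers a nonzero entry; a zero square forces a zero
    entry.\<close>
  have diag: "ip (g k) (g k) = ip (f k) (f k)" if k: "k \<in> A" for k
    using dbl[OF k k] tri[OF k k k]
    by (cases "ip (g k) (g k) = 0") (auto simp: double_product_def triple_product_def)
  have "ip (g j) (g k) = \<sigma> (t j) * t k * ip (f j) (f k)" if j: "j \<in> A" and k: "k \<in> A" for j k
  proof -
    consider "j = k" | "j = a" "k \<noteq> a" | "j \<noteq> a" "k = a" | "j \<noteq> a" "k \<noteq> a" "j \<noteq> k"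
      by blast
    then show ?thesis
    proof cases
      case 1
      then show ?thesis using diag[OF k] unit[OF k] by (simp add: mult.commute)
    next
      case 2
      then show ?thesis using tk[OF k] by (simp add: ta one)
    next
      case 3
      then show ?thesis using tk'[OF j] by (simp add: ta)
    next
      case 4
      \<comment> \<open>In the triple product through \<open>a\<close>, the two factors involving
        \<open>a\<close> are already compared, and they are nonzero, so the remaining factor is
        determined.\<close>
      have "ip (f j) (f k) * (ip (f a) (f j) * ip (f k) (f a))
          = t j * \<sigma> (t k) * ip (g j) (g k) * (ip (f a) (f j) * ip (f k) (f a))"
        using tri[OF a j k] tk[OF j 4(1)] tk'[OF k 4(2)]
        by (simp add: triple_product_def mult_ac)
      then have "ip (f j) (f k) = t j * \<sigma> (t k) * ip (g j) (g k)"
        using f[OF a j] f[OF k a] 4 by simp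
      \<comment> \<open>Multiplying by \<open>\<sigma> (t j) * t k\<close> solves for the entry of
        \<open>g\<close>, because both factors are units in the sense of
        \<open>unit\<close>.\<close>
      then have "\<sigma> (t j) * t k * ip (f j) (f k)
          = (t j * \<sigma> (t j)) * (t k * \<sigma> (t k)) * ip (g j) (g k)"
        by (simp add: mult_ac)
      then show ?thesis
        by (simp add: unit j k)
    qed
  qed
  then show ?thesis
    using unit by blast
qed simp

end

theorem theorem3p10:
  fixes scale :: "'a::{field,finite} \<Rightarrow> 'v::ab_group_add \<Rightarrow> 'v"
    and \<sigma> :: "'a \<Rightarrow> 'a"
    and ip :: "'v \<Rightarrow> 'v \<Rightarrow> 'a"
    and q n d :: nat
    and \<phi> \<psi> :: "nat \<Rightarrow> 'v"
  assumes "case_U q \<sigma> \<or> case_O q \<sigma>"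
    and "nonisotropic_space scale \<sigma> ip"
    and "vector_space.dim scale (UNIV :: 'v set) = d"
    and "is_frame scale n \<phi>"
    and "is_frame scale n \<psi>"
    and "\<And>j k. j \<in> {1..n} \<Longrightarrow> k \<in> {1..n} \<Longrightarrow> j \<noteq> k \<Longrightarrow> ip (\<phi> j) (\<phi> k) \<noteq> 0"
    and "\<And>j k. j \<in> {1..n} \<Longrightarrow> k \<in> {1..n} \<Longrightarrow> j \<noteq> k \<Longrightarrow> ip (\<psi> j) (\<psi> k) \<noteq> 0"
  shows "switching_equivalent scale \<sigma> ip n \<phi> \<psi> \<longleftrightarrow>
    (\<forall>j\<in>{1..n}. \<forall>k\<in>{1..n}.
        double_product ip (\<phi> j) (\<phi> k) = double_product ip (\<psi> j) (\<psi> k)) \<and>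
    (\<forall>j\<in>{1..n}. \<forall>k\<in>{1..n}. \<forall>l\<in>{1..n}.
        triple_product ip (\<phi> j) (\<phi> k) (\<phi> l) = triple_product ip (\<psi> j) (\<psi> k) (\<psi> l))"
  (is "?S \<longleftrightarrow> ?D \<and> ?T")
proof -
  interpret nonisotropic_space scale \<sigma> ip by fact
  note sigma = case_sigma_monoid_hom[OF assms(1)]
  have span: "span (\<phi> ` {1..n}) = UNIV" "span (\<psi> ` {1..n}) = UNIV"
    using assms(4,5) by (simp_all add: is_frame_def)
  show ?thesis
  proof
    assume ?S
    then obtain U t where U: "\<And>u v. ip (U u) (U v) = ip u v"
      and t: "\<And>j. j \<in> {1..n} \<Longrightarrow> t j * \<sigma> (t j) = 1"
      and eq: "\<And>j. j \<in> {1..n} \<Longrightarrow> \<psi> j = scale (t j) (U (\<phi> j))"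
      unfolding switching_equivalent_def is_unitary_def by blast
    have gram: "ip (\<psi> j) (\<psi> k) = \<sigma> (t j) * t k * ip (\<phi> j) (\<phi> k)"
      if "j \<in> {1..n}" "k \<in> {1..n}" for j k
      by (simp only: eq that ip_scale_left[OF sigma(1)] ip_scale_right U mult_ac)
    show "?D \<and> ?T"
    proof (intro conjI ballI)
      fix j k assume jk: "j \<in> {1..n}" "k \<in> {1..n}"
      \<comment> \<open>In a cyclic product each index position contributes once to a first slot and
        once to a second slot, so every \<open>t j\<close> meets its conjugate; triple products
        behave alike.\<close>
      have "double_product ip (\<psi> j) (\<psi> k)
          = (t j * \<sigma> (t j)) * (t k * \<sigma> (t k)) * double_product ip (\<phi> j) (\<phi> k)"
        unfolding double_product_def gram[OF jk] gram[OF jk(2,1)] by (simp only: mult_ac)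
      then show "double_product ip (\<phi> j) (\<phi> k) = double_product ip (\<psi> j) (\<psi> k)"
        by (simp only: t jk mult_1_left)
    next
      fix j k l assume jkl: "j \<in> {1..n}" "k \<in> {1..n}" "l \<in> {1..n}"
      have "triple_product ip (\<psi> j) (\<psi> k) (\<psi> l) = (t j * \<sigma> (t j)) * (t k * \<sigma> (t k))
          * (t l * \<sigma> (t l)) * triple_product ip (\<phi> j) (\<phi> k) (\<phi> l)"
        unfolding triple_product_def gram[OF jkl(1,2)] gram[OF jkl(2,3)] gram[OF jkl(3,1)]
        by (simp only: mult_ac)
      then show "triple_product ip (\<phi> j) (\<phi> k) (\<phi> l) = triple_product ip (\<psi> j) (\<psi> k) (\<psi> l)"
        by (simp only: t jkl mult_1_left)
    qed
  next
    assume DT: "?D \<and> ?T"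
    have "\<exists>t. (\<forall>j\<in>{1..n}. t j * \<sigma> (t j) = 1) \<and> (\<forall>j\<in>{1..n}. \<forall>k\<in>{1..n}.
        ip (\<psi> j) (\<psi> k) = \<sigma> (t j) * t k * ip (\<phi> j) (\<phi> k))"
      by (rule switching_factors_exist[OF sigma(1,3)]) (simp_all only: DT assms(6) not_False_eq_True)
    then obtain t where t: "\<And>j. j \<in> {1..n} \<Longrightarrow> t j * \<sigma> (t j) = 1"
      and gram: "\<And>j k. j \<in> {1..n} \<Longrightarrow> k \<in> {1..n} \<Longrightarrow>
        ip (\<psi> j) (\<psi> k) = \<sigma> (t j) * t k * ip (\<phi> j) (\<phi> k)"
      by blast
    \<comment> \<open>Absorbing the factors into the frame before applying \<open>U\<close> leaves
      two frames with equal Gram matrices; linearity of \<open>U\<close> later pulls the factors out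
      again.\<close>
    let ?f = "\<lambda>j. scale (t j) (\<phi> j)"
    have "t j \<noteq> 0" if "j \<in> {1..n}" for j
      using t[OF that] by auto
    then have "span (?f ` {1..n}) = UNIV"
      using span_scale_image[of "{1..n}" t \<phi>] span(1) by blast
    moreover have "ip (\<psi> j) (\<psi> k) = ip (?f j) (?f k)" if "j \<in> {1..n}" "k \<in> {1..n}" for j k
      by (simp only: gram that ip_scale_left[OF sigma(1)] ip_scale_right mult_ac)
    ultimately have "\<exists>U. is_unitary scale ip U \<and> (\<forall>j\<in>{1..n}. U (?f j) = \<psi> j)"
      by (rule ex_unitary_if_same_gram[OF sigma(2) _ span(2)])
    then obtain U where U: "is_unitary scale ip U"
      and eq: "\<And>j. j \<in> {1..n} \<Longrightarrow> U (?f j) = \<psi> j"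
      by blast
    have "U (scale c v) = scale c (U v)" for c v
      using U unfolding is_unitary_def by (simp add: Vector_Spaces.linear_iff)
    then have "\<psi> j = scale (t j) (U (\<phi> j))" if "j \<in> {1..n}" for j
      using eq[OF that] by simp
    then show ?S
      unfolding switching_equivalent_def using U t by blast
  qed
qed

end
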